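(* Let $G$ be a connected graph of order $n\ge 3$. (i) If $n$ is even, then $\gamma_1^{\mathrm L}(G)=\frac n2$ if and only if there exists a partition $(D,S)$ of $V(G)$ such that $G[D,S]$ is a disjoint union of $\frac n2$ copies of $K_2$. (ii) If $n$ is odd, then $\gamma_1^{\mathrm L}(G)=\lceil \frac n2\rceil$ if and only if there exists a partition $(D,S)$ of $V(G)$ with $|D|=\lceil \frac n2\rceil$ such that $G[D,S]$ is either a disjoint union of $\lfloor \frac n2\rfloor$ copies of $K_2$ and one isolated vertex lying in $D$, or a disjoint union of $\lfloor \frac n2\rfloor-1$ copies of $K_2$ and a path $P_3$ with the central vertex lying in $S$.
   Context: All graphs are finite, simple and undirected; $N(v)$ is the open neighborhood of $v$. A dominating set of $G$ is a set $D\subseteq V(G)$ such that every vertex not in $D$ has a neighbor in $D$. A $1$-limited dominating set is a dominating set $D$ with $|N(u)-D|\le 1$ for every $u\in D$; $\gamma_1^{\mathrm L}(G)$ is the minimum cardinality of a $1$-limited dominating set. For a partition $(D,S)$ of $V(G)$ into nonempty sets, $G[D,S]$ denotes the bipartite spanning subgraph of $G$ with partite sets $D$ and $S$ whose edge set consists exactly of all edges of $G$ with one endvertex in $D$ and the other in $S$. $K_2$ is the complete graph on $2$ vertices and $P_3$ the path on $3$ vertices. *)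

theory Defs
  imports Complex_Main "Graph_Theory.Kuratowski"
begin

text \<open>
  A finite simple undirected graph is a \<^const>\<open>pair_graph\<close>: an edge between \<open>u\<close> and \<open>v\<close> is
  represented by the two arcs \<open>(u, v)\<close> and \<open>(v, u)\<close>.
\<close>

definition nbhd :: "'a pair_pre_digraph \<Rightarrow> 'a \<Rightarrow> 'a set" where
  "nbhd G v = {u. (v, u) \<in> parcs G}"

definition dominating_set :: "'a pair_pre_digraph \<Rightarrow> 'a set \<Rightarrow> bool" where
  "dominating_set G D \<longleftrightarrow> D \<subseteq> pverts G \<and> (\<forall>v \<in> pverts G - D. nbhd G v \<inter> D \<noteq> {})"

definition one_limited_dominating_set :: "'a pair_pre_digraph \<Rightarrow> 'a set \<Rightarrow> bool" where
  "one_limited_dominating_set G D \<longleftrightarrow>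
    dominating_set G D \<and> (\<forall>u \<in> D. card (nbhd G u - D) \<le> 1)"

definition one_limited_dom_number :: "'a pair_pre_digraph \<Rightarrow> nat" where
  "one_limited_dom_number G = Min (card ` {D. one_limited_dominating_set G D})"

text \<open>
  For a finite graph this minimum is over a finite nonempty set: the whole vertex set
  qualifies.
\<close>

lemma one_limited_dominating_set_pverts:
  assumes "pair_graph G"
  shows "one_limited_dominating_set G (pverts G)"
proof -
  interpret pair_graph G by fact
  have "nbhd G u - pverts G = {}" for u
    unfolding nbhd_def by (auto dest: in_arcsD2)
  then have "card (nbhd G u - pverts G) = 0" for u
    by (simp only: card.empty)
  then show ?thesis
    by (auto simp only: one_limited_dominating_set_def dominating_set_def)
qed

lemma finite_one_limited_dominating_sets:
  assumes "pair_graph G"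
  shows "finite {D. one_limited_dominating_set G D}"
proof -
  interpret pair_graph G by fact
  have "{D. one_limited_dominating_set G D} \<subseteq> Pow (pverts G)"
    by (auto simp: one_limited_dominating_set_def dominating_set_def)
  then show ?thesis
    using finite_subset pair_finite_verts by blast
qed

definition vertex_bipartition :: "'a pair_pre_digraph \<Rightarrow> 'a set \<Rightarrow> 'a set \<Rightarrow> bool" where
  "vertex_bipartition G D S \<longleftrightarrow>
    D \<noteq> {} \<and> S \<noteq> {} \<and> D \<inter> S = {} \<and> D \<union> S = pverts G"

text \<open>The spanning subgraph \<open>G[D,S]\<close>.\<close>

definition cut_graph :: "'a pair_pre_digraph \<Rightarrow> 'a set \<Rightarrow> 'a set \<Rightarrow> 'a pair_pre_digraph" where
  "cut_graph G D S =
    \<lparr> pverts = pverts G, parcs = parcs G \<inter> (D \<times> S \<union> S \<times> D) \<rparr>"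

text \<open>
  \<open>H\<close> is the disjoint union of the graphs in \<open>F\<close>. Since the members are concrete graphs on the
  vertex type of \<open>H\<close>, a set of \<open>k\<close> nonempty graphs already gives \<open>k\<close> different components.
\<close>

definition disjoint_union_of :: "'a pair_pre_digraph \<Rightarrow> 'a pair_pre_digraph set \<Rightarrow> bool" where
  "disjoint_union_of H F \<longleftrightarrow>
    finite F \<and> (\<forall>C \<in> F. pair_graph C) \<and>
    pairwise (\<lambda>A B. pverts A \<inter> pverts B = {}) F \<and>
    pverts H = (\<Union>C \<in> F. pverts C) \<and> parcs H = (\<Union>C \<in> F. parcs C)"

definition copies_K2 :: "nat \<Rightarrow> 'a pair_pre_digraph set \<Rightarrow> bool" where
  "copies_K2 k F \<longleftrightarrow> finite F \<and> card F = k \<and> (\<forall>C \<in> F. K\<^bsub>2\<^esub> (with_proj C))"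

definition single_vertex_graph :: "'a \<Rightarrow> 'a pair_pre_digraph" where
  "single_vertex_graph x = \<lparr> pverts = {x}, parcs = {} \<rparr>"

definition is_P3_with_center :: "'a \<Rightarrow> 'a pair_pre_digraph \<Rightarrow> bool" where
  "is_P3_with_center b P \<longleftrightarrow>
    (\<exists>a c. distinct [a, b, c] \<and>
      P = \<lparr> pverts = {a, b, c}, parcs = {(a, b), (b, a), (b, c), (c, b)} \<rparr>)"

end

theory Submission
  imports Defs
begin

text \<open>
  Let \<open>S\<close> be the complement of a 1-limited dominating set \<open>D\<close>. Sorting the edges between \<open>D\<close> and
  \<open>S\<close> by their end in \<open>S\<close> shows the shape of \<open>G[D,S]\<close>: a vertex of \<open>D\<close> has at most one neighbour
  in \<open>S\<close>, so the stars centred at the vertices of \<open>S\<close> are pairwise disjoint, and together with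
  the vertices of \<open>D\<close> that have no neighbour in \<open>S\<close> they make up the whole graph
  (\<open>cut_graph_disjoint_union_of_stars\<close>). As \<open>D\<close> dominates, every star has at least one leaf.
  Counting the vertices of \<open>D\<close> therefore gives
  \<open>|D| - |S| = |X| + (\<Sum>s \<in> S. deg s - 1)\<close>,
  where \<open>X\<close> is the set of vertices of \<open>D\<close> isolated in \<open>G[D,S]\<close>, \<open>deg s\<close> is the number of
  neighbours of \<open>s\<close> in \<open>D\<close>, and all summands are nonnegative
  (\<open>card_eq_excess\<close>).

  In particular \<open>|D| \<ge> |S|\<close>, which bounds the 1-limited domination number below by \<open>\<lceil>n/2\<rceil>\<close>. If
  \<open>n\<close> is even, equality means that the excess \<open>|D| - |S|\<close> vanishes, so that \<open>X\<close> is empty and all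
  stars are copies of \<open>K\<^sub>2\<close>. If \<open>n\<close> is odd, equality means that the excess is 1: either \<open>X\<close> is a
  single vertex and all stars are copies of \<open>K\<^sub>2\<close>, or \<open>X\<close> is empty and exactly one star has two
  leaves, which makes it a path \<open>P\<^sub>3\<close> with its centre in \<open>S\<close>.

  Conversely, being a 1-limited dominating set can be read off the components of \<open>G[D,S]\<close>
  (\<open>one_limited_dominating_set_from_components\<close>). When \<open>G[D,S]\<close> is a perfect matching the
  condition is symmetric in \<open>D\<close> and \<open>S\<close>, so both sets contain at least half of the vertices and
  hence exactly half.
\<close>

section \<open>Stars across the cut\<close>

definition star :: "'a pair_pre_digraph \<Rightarrow> 'a set \<Rightarrow> 'a \<Rightarrow> 'a pair_pre_digraph" where
  "star G D s =
    \<lparr> pverts = insert s (nbhd G s \<inter> D),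
      parcs = {s} \<times> (nbhd G s \<inter> D) \<union> (nbhd G s \<inter> D) \<times> {s} \<rparr>"

definition cut_isolated :: "'a pair_pre_digraph \<Rightarrow> 'a set \<Rightarrow> 'a set" where
  "cut_isolated G D = {d \<in> D. nbhd G d \<subseteq> D}"

lemma nbhd_sym:
  assumes "pair_graph G"
  shows "u \<in> nbhd G v \<longleftrightarrow> v \<in> nbhd G u"
proof -
  interpret pair_graph G by fact
  show ?thesis
    using pair_sym_arcs unfolding nbhd_def symmetric_def by (auto dest: symD)
qed

lemma nbhd_subset_pverts:
  assumes "pair_graph G"
  shows "nbhd G v \<subseteq> pverts G"
proof -
  interpret pair_graph G by fact
  show ?thesis unfolding nbhd_def by (auto dest: in_arcsD2)
qed

lemma finite_pverts: "pair_graph G \<Longrightarrow> finite (pverts G)"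
  by (simp add: pair_graph_def pair_digraph_def pair_fin_digraph_def
      pair_fin_digraph_axioms_def)

lemma finite_nbhd: "pair_graph G \<Longrightarrow> finite (nbhd G v)"
  by (rule finite_subset[OF nbhd_subset_pverts finite_pverts])

lemma pair_graph_star:
  assumes "pair_graph G" and "s \<notin> D"
  shows "pair_graph (star G D s)"
  using finite_nbhd[OF assms(1), of s] assms(2)
  by unfold_locales (auto simp: star_def symmetric_def sym_def)

lemma pair_graph_single_vertex_graph: "pair_graph (single_vertex_graph x)"
  by unfold_locales (auto simp: single_vertex_graph_def symmetric_def sym_def)

lemma unique_nbr_outside:
  assumes "pair_graph G" and "one_limited_dominating_set G D"
    and "d \<in> D" and "s \<in> nbhd G d - D" and "t \<in> nbhd G d - D"
  shows "s = t"
proof -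
  have "card (nbhd G d - D) \<le> Suc 0"
    using assms(2,3) by (simp add: one_limited_dominating_set_def)
  then show ?thesis
    using card_le_Suc0_iff_eq[of "nbhd G d - D"] finite_nbhd[OF assms(1), of d] assms(4,5)
    by auto
qed

text \<open>
  Every edge across the cut lies in the star of its end outside \<open>D\<close>. A vertex of \<open>D\<close> in two
  stars would have two neighbours outside \<open>D\<close>.
\<close>

lemma cut_graph_disjoint_union_of_stars:
  assumes G: "pair_graph G" and D: "one_limited_dominating_set G D"
  shows "disjoint_union_of (cut_graph G D (pverts G - D))
    (star G D ` (pverts G - D) \<union> single_vertex_graph ` cut_isolated G D)"
    (is "disjoint_union_of ?H (?St \<union> ?Is)")
proof -
  let ?S = "pverts G - D"
  have sub: "D \<subseteq> pverts G"
    using D by (simp add: one_limited_dominating_set_def dominating_set_def)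
  have fin: "finite (pverts G)"
    by (rule finite_pverts[OF G])
  have sym: "\<And>u v. (u, v) \<in> parcs G \<longleftrightarrow> (v, u) \<in> parcs G"
    using nbhd_sym[OF G] by (auto simp: nbhd_def)
  have uniq: "s = t" if "d \<in> D" "s \<in> ?S" "t \<in> ?S" "d \<in> nbhd G s" "d \<in> nbhd G t" for d s t
    using unique_nbr_outside[OF G D \<open>d \<in> D\<close>, of s t] that nbhd_sym[OF G, of d] by blast
  have "finite (?St \<union> ?Is)"
    using fin finite_subset[OF sub fin] by (auto simp: cut_isolated_def)
  moreover have "\<forall>C \<in> ?St \<union> ?Is. pair_graph C"
    using pair_graph_star[OF G] pair_graph_single_vertex_graph by auto
  moreover have "pairwise (\<lambda>A B. pverts A \<inter> pverts B = {}) (?St \<union> ?Is)"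
  proof -
    have 1: "pverts (star G D s) \<inter> pverts (star G D t) = {}"
      if "s \<in> ?S" "t \<in> ?S" "s \<noteq> t" for s t
      using that uniq by (auto simp: star_def)
    have 2: "pverts (star G D s) \<inter> pverts (single_vertex_graph x) = {}"
      if "s \<in> ?S" "x \<in> cut_isolated G D" for s x
      using that nbhd_sym[OF G, of x s]
      by (auto simp: star_def single_vertex_graph_def cut_isolated_def)
    have 3: "pverts (single_vertex_graph x) \<inter> pverts (single_vertex_graph y) = {}"
      if "x \<noteq> y" for x y :: 'a
      using that by (simp add: single_vertex_graph_def)
    show ?thesis
      unfolding pairwise_def
    proof (intro ballI impI)
      fix A B
      assume "A \<in> ?St \<union> ?Is" "B \<in> ?St \<union> ?Is" "A \<noteq> B"
      then show "pverts A \<inter> pverts B = {}"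
      proof (elim UnE imageE)
        fix s t assume "A = star G D s" "s \<in> ?S" "B = star G D t" "t \<in> ?S"
        with \<open>A \<noteq> B\<close> show ?thesis using 1[of s t] by auto
      next
        fix s x assume "A = star G D s" "s \<in> ?S"
          "B = single_vertex_graph x" "x \<in> cut_isolated G D"
        then show ?thesis using 2[of s x] by simp
      next
        fix x s assume "A = single_vertex_graph x" "x \<in> cut_isolated G D"
          "B = star G D s" "s \<in> ?S"
        then show ?thesis using 2[of s x] by (simp add: Int_commute)
      next
        fix x y assume "A = single_vertex_graph x" "B = single_vertex_graph y"
        with \<open>A \<noteq> B\<close> show ?thesis using 3[of x y] by auto
      qed
    qed
  qed
  moreover have "pverts ?H = (\<Union>C \<in> ?St \<union> ?Is. pverts C)"
  proof
    show "pverts ?H \<subseteq> (\<Union>C \<in> ?St \<union> ?Is. pverts C)"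
    proof
      fix v assume "v \<in> pverts ?H"
      then have v: "v \<in> pverts G" by (simp add: cut_graph_def)
      consider "v \<notin> D" | "v \<in> cut_isolated G D" | s where "v \<in> D" "s \<in> nbhd G v" "s \<notin> D"
        by (auto simp: cut_isolated_def)
      then show "v \<in> (\<Union>C \<in> ?St \<union> ?Is. pverts C)"
      proof cases
        case 3
        then have "s \<in> ?S" "v \<in> nbhd G s"
          using nbhd_subset_pverts[OF G, of v] nbhd_sym[OF G] by auto
        then show ?thesis using 3 by (auto simp: star_def)
      qed (use v in \<open>auto simp: star_def single_vertex_graph_def\<close>)
    qed
    show "(\<Union>C \<in> ?St \<union> ?Is. pverts C) \<subseteq> pverts ?H"
      using sub by (auto simp: cut_graph_def star_def single_vertex_graph_def cut_isolated_def)
  qed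
  moreover have "parcs ?H = (\<Union>C \<in> ?St \<union> ?Is. parcs C)"
    using sub sym
    by (auto simp: cut_graph_def star_def single_vertex_graph_def nbhd_def)
  ultimately show ?thesis
    unfolding disjoint_union_of_def by blast
qed

lemma star_leaf:
  assumes "pair_graph G" and "one_limited_dominating_set G D" and "s \<in> pverts G - D"
  shows "1 \<le> card (nbhd G s \<inter> D)"
proof -
  have "nbhd G s \<inter> D \<noteq> {}"
    using assms(2,3) by (auto simp: one_limited_dominating_set_def dominating_set_def)
  then show ?thesis
    using finite_nbhd[OF assms(1), of s] by (simp add: Suc_le_eq card_gt_0_iff)
qed

text \<open>
  The leaves of the stars together with the isolated vertices partition \<open>D\<close>. One leaf of each
  star is set against its centre; what remains is the excess of \<open>D\<close> over its complement.
\<close>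

lemma card_eq_excess:
  assumes G: "pair_graph G" and D: "one_limited_dominating_set G D"
  shows "card D = card (pverts G - D) + card (cut_isolated G D) +
    (\<Sum>s \<in> pverts G - D. card (nbhd G s \<inter> D) - 1)"
proof -
  let ?S = "pverts G - D"
  have sub: "D \<subseteq> pverts G"
    using D by (simp add: one_limited_dominating_set_def dominating_set_def)
  have fin: "finite (pverts G)"
    by (rule finite_pverts[OF G])
  have finD: "finite D" using finite_subset[OF sub fin] .
  have part: "D = cut_isolated G D \<union> (\<Union>s \<in> ?S. nbhd G s \<inter> D)"
    using nbhd_sym[OF G] nbhd_subset_pverts[OF G]
    unfolding cut_isolated_def by blast
  have "card D = card (cut_isolated G D) + card (\<Union>s \<in> ?S. nbhd G s \<inter> D)"
  proof (subst part, rule card_Un_disjoint)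
    show "cut_isolated G D \<inter> (\<Union>s \<in> ?S. nbhd G s \<inter> D) = {}"
      using nbhd_sym[OF G] by (auto simp: cut_isolated_def)
  qed (use fin finD in \<open>auto simp: cut_isolated_def\<close>)
  also have "card (\<Union>s \<in> ?S. nbhd G s \<inter> D) = (\<Sum>s \<in> ?S. card (nbhd G s \<inter> D))"
  proof (rule card_UN_disjoint)
    show "\<forall>s \<in> ?S. \<forall>t \<in> ?S. s \<noteq> t \<longrightarrow> (nbhd G s \<inter> D) \<inter> (nbhd G t \<inter> D) = {}"
      using unique_nbr_outside[OF G D] nbhd_sym[OF G] by blast
  qed (use fin finD in auto)
  also have "\<dots> = (\<Sum>s \<in> ?S. 1 + (card (nbhd G s \<inter> D) - 1))"
    by (intro sum.cong refl, use star_leaf[OF G D] in fastforce)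
  also have "\<dots> = card ?S + (\<Sum>s \<in> ?S. card (nbhd G s \<inter> D) - 1)"
    by (simp add: sum.distrib del: One_nat_def)
  finally show ?thesis by simp
qed

lemma card_complement_one_limited:
  assumes "pair_graph G" and "one_limited_dominating_set G D"
  shows "card (pverts G - D) = card (pverts G) - card D" and "card D \<le> card (pverts G)"
proof -
  have "D \<subseteq> pverts G"
    using assms(2) by (simp add: one_limited_dominating_set_def dominating_set_def)
  then show "card (pverts G - D) = card (pverts G) - card D" "card D \<le> card (pverts G)"
    using finite_pverts[OF assms(1)] by (auto simp: card_Diff_subset finite_subset card_mono)
qed

lemma half_le_card_one_limited:
  assumes "pair_graph G" and "one_limited_dominating_set G D"
  shows "card (pverts G) \<le> 2 * card D"
  using card_eq_excess[OF assms] card_complement_one_limited[OF assms] by linarith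

text \<open>
  The condition on \<open>k\<close> says \<open>k \<le> \<lceil>n/2\<rceil>\<close>, a lower bound for every candidate. So the minimum equals
  \<open>k\<close> as soon as the value \<open>k\<close> is attained.
\<close>

lemma one_limited_dom_number_eq_iff:
  assumes G: "pair_graph G" and k: "2 * k \<le> card (pverts G) + 1"
  shows "one_limited_dom_number G = k \<longleftrightarrow> (\<exists>D. one_limited_dominating_set G D \<and> card D = k)"
proof -
  let ?A = "card ` {D. one_limited_dominating_set G D}"
  have fin: "finite ?A" and ne: "?A \<noteq> {}"
    using finite_one_limited_dominating_sets[OF G] one_limited_dominating_set_pverts[OF G]
    by auto
  have "k \<le> m" if "m \<in> ?A" for m
    using that half_le_card_one_limited[OF G] k by fastforce
  then have "Min ?A = k \<longleftrightarrow> k \<in> ?A"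
    using Min_eq_iff[OF fin ne] by blast
  then show ?thesis
    unfolding one_limited_dom_number_def by auto
qed

lemma vertex_bipartition_complement:
  assumes "pair_graph G" and "one_limited_dominating_set G D"
    and "card D < card (pverts G)"
  shows "vertex_bipartition G D (pverts G - D)"
proof -
  have "D \<subseteq> pverts G"
    using assms(2) by (simp add: one_limited_dominating_set_def dominating_set_def)
  moreover have "D \<noteq> {}"
    using half_le_card_one_limited[OF assms(1,2)] assms(3) by auto
  ultimately show ?thesis
    using assms(3) by (auto simp: vertex_bipartition_def)
qed

section \<open>Small stars\<close>

lemma K2_star:
  assumes "s \<notin> D" and "card (nbhd G s \<inter> D) = 1"
  shows "K\<^bsub>2\<^esub> (with_proj (star G D s))"
proof -
  obtain d where d: "nbhd G s \<inter> D = {d}"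
    using assms(2) by (auto simp: card_1_singleton_iff)
  with assms(1) have "s \<noteq> d" by auto
  then show ?thesis
    by (auto simp: complete_digraph_pair_def star_def d)
qed

lemma P3_star:
  assumes "s \<notin> D" and "card (nbhd G s \<inter> D) = 2"
  shows "is_P3_with_center s (star G D s)"
proof -
  obtain a c where ac: "nbhd G s \<inter> D = {a, c}" "a \<noteq> c"
    using assms(2) by (auto simp: card_2_iff)
  with assms(1) have "distinct [a, s, c]" by auto
  moreover have
    "star G D s = \<lparr> pverts = {a, s, c}, parcs = {(a, s), (s, a), (s, c), (c, s)} \<rparr>"
    unfolding star_def ac by auto
  ultimately show ?thesis
    unfolding is_P3_with_center_def by blast
qed

text \<open>
  The number of stars equals the number of centres, because a star determines its centre as its
  only vertex outside \<open>D\<close>.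
\<close>

lemma copies_K2_stars:
  assumes "finite T" and "T \<inter> D = {}" and "\<forall>s \<in> T. card (nbhd G s \<inter> D) = 1"
  shows "copies_K2 (card T) (star G D ` T)"
proof -
  have "inj_on (star G D) T"
  proof (rule inj_onI)
    fix s t assume "s \<in> T" "t \<in> T" and eq: "star G D s = star G D t"
    have "pverts (star G D s) - D = {s}" "pverts (star G D t) - D = {t}"
      using \<open>s \<in> T\<close> \<open>t \<in> T\<close> assms(2) by (auto simp: star_def)
    then have "{s} = {t}" unfolding eq by simp
    then show "s = t" by simp
  qed
  then show ?thesis
    using assms K2_star[of _ D G] by (auto simp: copies_K2_def card_image)
qed

section \<open>Reading 1-limited domination off the components\<close>

text \<open>
  An edge across the cut belongs to the component containing its first end. Hence it suffices to
  check in each component that no vertex of \<open>S\<close> is isolated and that no vertex of \<open>D\<close> has two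
  neighbours.
\<close>

lemma one_limited_dominating_set_from_components:
  assumes G: "pair_graph G" and bip: "vertex_bipartition G D S"
    and union: "disjoint_union_of (cut_graph G D S) F"
    and nonisolated: "\<And>C v. C \<in> F \<Longrightarrow> v \<in> pverts C \<Longrightarrow> v \<in> S \<Longrightarrow> \<exists>w. (v, w) \<in> parcs C"
    and unique: "\<And>C u v w. C \<in> F \<Longrightarrow> u \<in> D \<Longrightarrow> (u, v) \<in> parcs C \<Longrightarrow> (u, w) \<in> parcs C \<Longrightarrow> v = w"
  shows "one_limited_dominating_set G D"
proof -
  have DS: "D \<inter> S = {}" "D \<union> S = pverts G"
    using bip by (auto simp: vertex_bipartition_def)
  have wf: "pair_wf_digraph C" if "C \<in> F" for C
    using that union
    by (auto simp: disjoint_union_of_def pair_graph_def pair_digraph_def pair_fin_digraph_def)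
  have verts: "pverts G = (\<Union>C \<in> F. pverts C)"
    using union by (auto simp: disjoint_union_of_def cut_graph_def)
  have arcs: "parcs G \<inter> (D \<times> S \<union> S \<times> D) = (\<Union>C \<in> F. parcs C)"
    using union by (auto simp: disjoint_union_of_def cut_graph_def)
  have same: "A = B" if "A \<in> F" "B \<in> F" "u \<in> pverts A" "u \<in> pverts B" for A B u
    using that union by (auto simp: disjoint_union_of_def pairwise_def)
  have "nbhd G v \<inter> D \<noteq> {}" if "v \<in> pverts G - D" for v
  proof -
    have "v \<in> S" using that DS by auto
    moreover have "v \<in> (\<Union>C \<in> F. pverts C)" using that unfolding verts by simp
    then obtain C where "C \<in> F" "v \<in> pverts C" by blast
    ultimately obtain w where "(v, w) \<in> parcs C" using nonisolated by blast
    then have "(v, w) \<in> parcs G \<inter> (D \<times> S \<union> S \<times> D)"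
      using \<open>C \<in> F\<close> arcs by blast
    then show ?thesis using \<open>v \<in> S\<close> DS by (auto simp: nbhd_def)
  qed
  moreover have "card (nbhd G u - D) \<le> 1" if u: "u \<in> D" for u
  proof -
    have "v = w" if "v \<in> nbhd G u - D" "w \<in> nbhd G u - D" for v w
    proof -
      have "v \<in> S" "w \<in> S"
        using that nbhd_subset_pverts[OF G, of u] DS by auto
      then have "(u, v) \<in> (\<Union>C \<in> F. parcs C)" "(u, w) \<in> (\<Union>C \<in> F. parcs C)"
        using that u arcs by (auto simp: nbhd_def)
      then obtain A B where AB: "A \<in> F" "(u, v) \<in> parcs A" "B \<in> F" "(u, w) \<in> parcs B"
        by blast
      then have "A = B"
        using same pair_wf_digraph.in_arcsD1[OF wf] by blast
      with AB unique u show ?thesis by blast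
    qed
    then show ?thesis
      using card_le_Suc0_iff_eq[of "nbhd G u - D"] finite_nbhd[OF G, of u] by auto
  qed
  ultimately show ?thesis
    using DS unfolding one_limited_dominating_set_def dominating_set_def by blast
qed

lemma K2_vertex_has_arc:
  assumes "K\<^bsub>2\<^esub> (with_proj C)" and "v \<in> pverts C"
  shows "\<exists>w. (v, w) \<in> parcs C"
proof -
  obtain a b where "pverts C = {a, b}" "a \<noteq> b"
    using assms(1) by (auto simp: complete_digraph_pair_def card_2_iff)
  then show ?thesis
    using assms by (auto simp: complete_digraph_pair_def)
qed

lemma K2_arc_unique:
  assumes "K\<^bsub>2\<^esub> (with_proj C)" and "(u, v) \<in> parcs C" and "(u, w) \<in> parcs C"
  shows "v = w"
proof -
  obtain a b where "pverts C = {a, b}"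
    using assms(1) by (auto simp: complete_digraph_pair_def card_2_iff)
  then show ?thesis
    using assms by (auto simp: complete_digraph_pair_def)
qed

lemma copies_K2D: "copies_K2 k F \<Longrightarrow> C \<in> F \<Longrightarrow> K\<^bsub>2\<^esub> (with_proj C)"
  by (simp add: copies_K2_def)

lemma one_limited_of_K2s:
  assumes "pair_graph G" and "vertex_bipartition G D S"
    and "copies_K2 k F" and "disjoint_union_of (cut_graph G D S) F"
  shows "one_limited_dominating_set G D"
proof (rule one_limited_dominating_set_from_components[OF assms(1,2,4)])
  show "\<exists>w. (v, w) \<in> parcs C" if "C \<in> F" "v \<in> pverts C" for C v
    by (rule K2_vertex_has_arc[OF copies_K2D[OF assms(3)] that(2)]) (rule that(1))
  show "v = w" if "C \<in> F" "(u, v) \<in> parcs C" "(u, w) \<in> parcs C" for C u v w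
    by (rule K2_arc_unique[OF copies_K2D[OF assms(3)] that(2,3)]) (rule that(1))
qed

lemma one_limited_of_K2s_and_vertex:
  assumes "pair_graph G" and bip: "vertex_bipartition G D S" and "x \<in> D"
    and K2: "copies_K2 k F"
    and "disjoint_union_of (cut_graph G D S) (insert (single_vertex_graph x) F)"
  shows "one_limited_dominating_set G D"
proof (rule one_limited_dominating_set_from_components[OF assms(1,2,5)])
  have "x \<notin> S" using bip \<open>x \<in> D\<close> by (auto simp: vertex_bipartition_def)
  then show "\<exists>w. (v, w) \<in> parcs C"
    if "C \<in> insert (single_vertex_graph x) F" "v \<in> pverts C" "v \<in> S" for C v
  proof -
    have "C \<in> F" using that \<open>x \<notin> S\<close> by (auto simp: single_vertex_graph_def)
    then show ?thesis using K2_vertex_has_arc[OF copies_K2D[OF K2]] that(2) by blast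
  qed
  show "v = w" if "C \<in> insert (single_vertex_graph x) F"
    and uvw: "(u, v) \<in> parcs C" "(u, w) \<in> parcs C" for C u v w
  proof -
    have "C \<in> F" using that by (auto simp: single_vertex_graph_def)
    then show ?thesis by (rule K2_arc_unique[OF copies_K2D[OF K2] uvw])
  qed
qed

lemma one_limited_of_K2s_and_P3:
  assumes "pair_graph G" and bip: "vertex_bipartition G D S" and "b \<in> S"
    and K2: "copies_K2 k F" and P: "is_P3_with_center b P"
    and "disjoint_union_of (cut_graph G D S) (insert P F)"
  shows "one_limited_dominating_set G D"
proof (rule one_limited_dominating_set_from_components[OF assms(1,2,6)])
  have "b \<notin> D" using bip \<open>b \<in> S\<close> by (auto simp: vertex_bipartition_def)
  have P_arc: "\<exists>w. (v, w) \<in> parcs P" if "v \<in> pverts P" for v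
    using P that by (auto simp: is_P3_with_center_def)
  have P_unique: "v = w" if "u \<noteq> b" "(u, v) \<in> parcs P" "(u, w) \<in> parcs P" for u v w
    using P that by (auto simp: is_P3_with_center_def)
  show "\<exists>w. (v, w) \<in> parcs C" if "C \<in> insert P F" "v \<in> pverts C" for C v
    using that P_arc K2_vertex_has_arc[OF copies_K2D[OF K2]] by blast
  show "v = w"
    if "C \<in> insert P F" "u \<in> D" "(u, v) \<in> parcs C" "(u, w) \<in> parcs C" for C u v w
    using that P_unique[of u v w] \<open>b \<notin> D\<close> K2_arc_unique[OF copies_K2D[OF K2]] by blast
qed

section \<open>The two parities\<close>

lemma perfect_matching_of_excess_0:
  assumes G: "pair_graph G" and D: "one_limited_dominating_set G D"
    and card: "card D = card (pverts G - D)"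
  shows "\<exists>F. copies_K2 (card D) F \<and> disjoint_union_of (cut_graph G D (pverts G - D)) F"
proof -
  let ?S = "pverts G - D"
  have fin: "finite (pverts G)"
    by (rule finite_pverts[OF G])
  have "finite D"
    using D fin finite_subset
    by (auto simp: one_limited_dominating_set_def dominating_set_def)
  then have "cut_isolated G D = {}"
    using card_eq_excess[OF G D] card by (auto simp: cut_isolated_def)
  moreover have "(\<Sum>s \<in> ?S. card (nbhd G s \<inter> D) - 1) = 0"
    using card_eq_excess[OF G D] card by linarith
  then have "\<forall>s \<in> ?S. card (nbhd G s \<inter> D) = 1"
    using star_leaf[OF G D] fin by (auto intro: le_antisym)
  then have "copies_K2 (card D) (star G D ` ?S)"
    using copies_K2_stars[of ?S D G] card fin by auto
  ultimately show ?thesis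
    using cut_graph_disjoint_union_of_stars[OF G D] by auto
qed

lemma near_perfect_matching_of_excess_1:
  assumes G: "pair_graph G" and D: "one_limited_dominating_set G D"
    and card: "card D = card (pverts G - D) + 1"
  defines "S \<equiv> pverts G - D"
  shows "(\<exists>F. \<exists>x \<in> D. copies_K2 (card S) F \<and>
            disjoint_union_of (cut_graph G D S) (insert (single_vertex_graph x) F)) \<or>
         (\<exists>F P. \<exists>b \<in> S. copies_K2 (card S - 1) F \<and> is_P3_with_center b P \<and>
            disjoint_union_of (cut_graph G D S) (insert P F))"
proof -
  let ?X = "cut_isolated G D" and ?e = "\<lambda>s. card (nbhd G s \<inter> D) - 1"
  have fin: "finite S"
    using finite_pverts[OF G] by (simp add: S_def)
  have "finite D"
    using D finite_pverts[OF G] finite_subset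
    by (auto simp: one_limited_dominating_set_def dominating_set_def)
  then have finX: "finite ?X" by (simp add: cut_isolated_def)
  have leaf: "\<forall>s \<in> S. 1 \<le> card (nbhd G s \<inter> D)"
    using star_leaf[OF G D] by (simp add: S_def)
  have union: "disjoint_union_of (cut_graph G D S) (star G D ` S \<union> single_vertex_graph ` ?X)"
    using cut_graph_disjoint_union_of_stars[OF G D] by (simp add: S_def)
  have "card ?X + sum ?e S = 1"
    using card_eq_excess[OF G D] card by (simp add: S_def)
  \<comment> \<open>The single surplus vertex of \<open>D\<close> is either isolated or a second leaf of one star.\<close>
  then consider "card ?X = 1" "sum ?e S = 0" | "card ?X = 0" "sum ?e S = 1"
    by linarith
  then show ?thesis
  proof cases
    case 1
    then obtain x where X: "?X = {x}" by (auto simp: card_1_singleton_iff)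
    then have "x \<in> D" by (auto simp: cut_isolated_def)
    moreover have "\<forall>s \<in> S. card (nbhd G s \<inter> D) = 1"
      using 1 leaf fin by fastforce
    then have "copies_K2 (card S) (star G D ` S)"
      using copies_K2_stars[of S D G] fin by (auto simp: S_def)
    ultimately show ?thesis using union X by auto
  next
    case 2
    then have X: "?X = {}" using finX by simp
    obtain b where b: "b \<in> S" "?e b = 1" "\<forall>s \<in> S. b \<noteq> s \<longrightarrow> ?e s = 0"
      using 2(2) sum_eq_1_iff[OF fin, of ?e] by blast
    have "card (nbhd G b \<inter> D) = 2" using b(2) by linarith
    then have P3: "is_P3_with_center b (star G D b)"
      using b(1) by (intro P3_star) (simp_all add: S_def)
    have "\<forall>s \<in> S - {b}. card (nbhd G s \<inter> D) = 1"
      using b(3) leaf by fastforce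
    then have "copies_K2 (card (S - {b})) (star G D ` (S - {b}))"
      using fin by (intro copies_K2_stars) (auto simp: S_def)
    then have K2: "copies_K2 (card S - 1) (star G D ` (S - {b}))"
      using b(1) fin by simp
    have "star G D ` S = insert (star G D b) (star G D ` (S - {b}))"
      using b(1) by auto
    then have "disjoint_union_of (cut_graph G D S)
        (insert (star G D b) (star G D ` (S - {b})))"
      using union X by simp
    with b(1) P3 K2 show ?thesis by blast
  qed
qed

text \<open>
  Swapping \<open>D\<close> and \<open>S\<close> does not change \<open>G[D,S]\<close>, so both are 1-limited dominating sets and the
  lower bound applies to each of them.
\<close>

lemma card_eq_half_of_K2s:
  assumes G: "pair_graph G" and bip: "vertex_bipartition G D S"
    and F: "copies_K2 k F" "disjoint_union_of (cut_graph G D S) F"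
  shows "card (pverts G) = 2 * card D"
proof -
  have bip': "vertex_bipartition G S D"
    using bip by (auto simp: vertex_bipartition_def)
  have "cut_graph G S D = cut_graph G D S"
    by (simp add: cut_graph_def Un_commute)
  then have "one_limited_dominating_set G S"
    using one_limited_of_K2s[OF G bip' F(1)] F(2) by simp
  then have "card (pverts G) \<le> 2 * card S"
    by (rule half_le_card_one_limited[OF G])
  moreover have "card (pverts G) \<le> 2 * card D"
    by (rule half_le_card_one_limited[OF G one_limited_of_K2s[OF G bip F]])
  moreover have "D \<union> S = pverts G" "D \<inter> S = {}"
    using bip by (auto simp: vertex_bipartition_def)
  then have "card (pverts G) = card D + card S"
    using finite_pverts[OF G] card_Un_disjoint[of D S] by (metis finite_Un)
  ultimately show ?thesis by linarith
qed

theorem corollary14: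
  fixes G :: "'a pair_pre_digraph" and n :: nat
  assumes "pair_graph G"
    and "Digraph_Component.connected (with_proj G)"
    and "card (pverts G) = n"
    and "n \<ge> 3"
  shows
    "(even n \<longrightarrow>
       (one_limited_dom_number G = n div 2 \<longleftrightarrow>
         (\<exists>D S. vertex_bipartition G D S \<and>
           (\<exists>F. copies_K2 (n div 2) F \<and> disjoint_union_of (cut_graph G D S) F)))) \<and>
     (odd n \<longrightarrow>
       (one_limited_dom_number G = nat \<lceil>real n / 2\<rceil> \<longleftrightarrow>
         (\<exists>D S. vertex_bipartition G D S \<and> card D = nat \<lceil>real n / 2\<rceil> \<and>
           ((\<exists>F. \<exists>x \<in> D. copies_K2 (nat \<lfloor>real n / 2\<rfloor>) F \<and>
               disjoint_union_of (cut_graph G D S) (insert (single_vertex_graph x) F)) \<or>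
            (\<exists>F P. \<exists>b \<in> S. copies_K2 (nat \<lfloor>real n / 2\<rfloor> - 1) F \<and> is_P3_with_center b P \<and>
               disjoint_union_of (cut_graph G D S) (insert P F))))))"
proof (intro conjI impI)
  note G = assms(1) and n = assms(3)
  assume "even n"
  then have half: "2 * (n div 2) = n" by simp
  then have dom_number: "one_limited_dom_number G = n div 2 \<longleftrightarrow>
      (\<exists>D. one_limited_dominating_set G D \<and> card D = n div 2)"
    using n by (intro one_limited_dom_number_eq_iff[OF G]) simp
  show "one_limited_dom_number G = n div 2 \<longleftrightarrow>
      (\<exists>D S. vertex_bipartition G D S \<and>
        (\<exists>F. copies_K2 (n div 2) F \<and> disjoint_union_of (cut_graph G D S) F))"
    (is "_ \<longleftrightarrow> ?R")
    unfolding dom_number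
  proof
    assume "\<exists>D. one_limited_dominating_set G D \<and> card D = n div 2"
    then obtain D where D: "one_limited_dominating_set G D" "card D = n div 2" by blast
    then have "card D = card (pverts G - D)"
      using card_complement_one_limited(1)[OF G D(1)] n half by linarith
    from perfect_matching_of_excess_0[OF G D(1) this]
    have "\<exists>F. copies_K2 (n div 2) F \<and> disjoint_union_of (cut_graph G D (pverts G - D)) F"
      unfolding D(2) .
    moreover have "vertex_bipartition G D (pverts G - D)"
      using vertex_bipartition_complement[OF G D(1)] D(2) assms(4) n by simp
    ultimately show ?R by blast
  next
    assume ?R
    then obtain D S F where *: "vertex_bipartition G D S" "copies_K2 (n div 2) F"
        "disjoint_union_of (cut_graph G D S) F"
      by blast
    have "card D = n div 2"
      using card_eq_half_of_K2s[OF G *] n by simp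
    with one_limited_of_K2s[OF G *]
    show "\<exists>D. one_limited_dominating_set G D \<and> card D = n div 2" by blast
  qed
next
  note G = assms(1) and n = assms(3)
  assume "odd n"
  then obtain k where k: "n = 2 * k + 1" by (auto elim: oddE)
  have ceil: "nat \<lceil>real n / 2\<rceil> = k + 1"
    using ceiling_eq_iff[of "real n / 2" "int k + 1"] by (simp add: k)
  have floor: "nat \<lfloor>real n / 2\<rfloor> = k"
    using floor_eq_iff[of "real n / 2" "int k"] by (simp add: k)
  have dom_number: "one_limited_dom_number G = k + 1 \<longleftrightarrow>
      (\<exists>D. one_limited_dominating_set G D \<and> card D = k + 1)"
    using n k by (intro one_limited_dom_number_eq_iff[OF G]) simp
  show "one_limited_dom_number G = nat \<lceil>real n / 2\<rceil> \<longleftrightarrow>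
      (\<exists>D S. vertex_bipartition G D S \<and> card D = nat \<lceil>real n / 2\<rceil> \<and>
        ((\<exists>F. \<exists>x \<in> D. copies_K2 (nat \<lfloor>real n / 2\<rfloor>) F \<and>
            disjoint_union_of (cut_graph G D S) (insert (single_vertex_graph x) F)) \<or>
         (\<exists>F P. \<exists>b \<in> S. copies_K2 (nat \<lfloor>real n / 2\<rfloor> - 1) F \<and> is_P3_with_center b P \<and>
            disjoint_union_of (cut_graph G D S) (insert P F))))"
    unfolding ceil floor dom_number
  proof
    assume "\<exists>D. one_limited_dominating_set G D \<and> card D = k + 1"
    then obtain D where D: "one_limited_dominating_set G D" "card D = k + 1" by blast
    have S: "card (pverts G - D) = k"
      using card_complement_one_limited(1)[OF G D(1)] n k D(2) by linarith
    \<comment> \<open>The complement is nonempty since \<open>\<lceil>n/2\<rceil> < n\<close> for \<open>n \<ge> 3\<close>.\<close>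
    have "vertex_bipartition G D (pverts G - D)"
      using vertex_bipartition_complement[OF G D(1)] n k D(2) assms(4) by simp
    moreover have "card D = card (pverts G - D) + 1"
      unfolding S D(2) ..
    note near_perfect_matching_of_excess_1[OF G D(1) this, unfolded S]
    ultimately show "\<exists>D S. vertex_bipartition G D S \<and> card D = k + 1 \<and>
        ((\<exists>F. \<exists>x \<in> D. copies_K2 k F \<and>
            disjoint_union_of (cut_graph G D S) (insert (single_vertex_graph x) F)) \<or>
         (\<exists>F P. \<exists>b \<in> S. copies_K2 (k - 1) F \<and> is_P3_with_center b P \<and>
            disjoint_union_of (cut_graph G D S) (insert P F)))"
      using D(2) by blast
  next
    assume "\<exists>D S. vertex_bipartition G D S \<and> card D = k + 1 \<and>
        ((\<exists>F. \<exists>x \<in> D. copies_K2 k F \<and>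
            disjoint_union_of (cut_graph G D S) (insert (single_vertex_graph x) F)) \<or>
         (\<exists>F P. \<exists>b \<in> S. copies_K2 (k - 1) F \<and> is_P3_with_center b P \<and>
            disjoint_union_of (cut_graph G D S) (insert P F)))"
    then show "\<exists>D. one_limited_dominating_set G D \<and> card D = k + 1"
      using one_limited_of_K2s_and_vertex[OF G] one_limited_of_K2s_and_P3[OF G] by blast
  qed
qed


end
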